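(* Let $z=a+jb\in\mathbb{Z}[j]$ be a Gaussian integer with $ab\neq 0$. Then $z$ is a Gaussian prime if and only if its matrix representation $\left(\begin{array}{cc} a & -b\\ b & a\end{array}\right)$ is a prime $2\times 2$ integer matrix.
   Context: $j=\sqrt{-1}$ and $\mathbb{Z}[j]$ is the ring of Gaussian integers $a+jb$ with $a,b\in\mathbb{Z}$. A Gaussian integer is a unit if its absolute value is $1$. A Gaussian integer is a Gaussian prime if it cannot be factored as a product of two non-unit Gaussian integers. An integer matrix is unimodular if its determinant is $\pm1$, and non-unimodular otherwise. A nonsingular integer matrix is called prime if it cannot be factorized as a product of two non-unimodular integer matrices. *)

theory Defs
  imports "HOL-Analysis.Analysis"
begin

definition gaussian_integers :: "complex set" where
  "gaussian_integers = {of_int a + \<i> * of_int b | a b :: int. True}"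

definition gaussian_unit :: "complex \<Rightarrow> bool" where
  "gaussian_unit z \<longleftrightarrow> z \<in> gaussian_integers \<and> cmod z = 1"

(* No exclusion of units is intended, so units count as Gaussian primes here;
   likewise unimodular matrices count as prime below. *)
definition gaussian_prime :: "complex \<Rightarrow> bool" where
  "gaussian_prime z \<longleftrightarrow> z \<in> gaussian_integers \<and>
     \<not> (\<exists>x \<in> gaussian_integers. \<exists>y \<in> gaussian_integers.
          \<not> gaussian_unit x \<and> \<not> gaussian_unit y \<and> z = x * y)"

definition unimodular :: "int ^ 'n ^ 'n \<Rightarrow> bool" where
  "unimodular M \<longleftrightarrow> det M = 1 \<or> det M = - 1"

definition prime_matrix :: "int ^ 'n ^ 'n \<Rightarrow> bool" where
  "prime_matrix M \<longleftrightarrow> det M \<noteq> 0 \<and>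
     \<not> (\<exists>A B :: int ^ 'n ^ 'n. \<not> unimodular A \<and> \<not> unimodular B \<and> M = A ** B)"

definition gaussian_matrix :: "int \<Rightarrow> int \<Rightarrow> int ^ 2 ^ 2" where
  "gaussian_matrix a b = vector [vector [a, - b], vector [b, a]]"

end

(* A factorization of the matrix of z into non-unimodular factors gives cmod z ^ 2 = d * e with
   integers d, e > 1. Let g be a gcd of z and d in the Euclidean ring of Gaussian integers, and
   z = g * s. If g is a unit, then Bezout shows that d divides cnj z; if s is a unit, then z divides
   d and hence e divides cnj z. So if z is a Gaussian prime, then a rational integer m > 1 divides
   both a and b, and z = m * (z / m), where z / m is not a unit because a and b are nonzero. *)

theory Submission imports Defs begin

section \<open>Arithmetic of Gaussian integers in coordinates\<close>

lemma gaussian_integers_of_int [intro, simp]: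
  "of_int a + \<i> * of_int b \<in> gaussian_integers"
  unfolding gaussian_integers_def by blast

lemma of_int_in_gaussian_integers [intro, simp]: "of_int a \<in> gaussian_integers"
  using gaussian_integers_of_int[of a 0] by simp

lemma gaussian_integers_0 [intro, simp]: "0 \<in> gaussian_integers"
  using of_int_in_gaussian_integers[of 0] by simp

lemma gaussian_integers_1 [intro, simp]: "1 \<in> gaussian_integers"
  using of_int_in_gaussian_integers[of 1] by simp

lemma gaussian_integersE:
  assumes "x \<in> gaussian_integers"
  obtains a b where "x = of_int a + \<i> * of_int b"
  using assms unfolding gaussian_integers_def by blast

lemma gaussian_integers_diff [intro]:
  assumes "x \<in> gaussian_integers" "y \<in> gaussian_integers"
  shows "x - y \<in> gaussian_integers"
proof -
  obtain a b c d where "x = of_int a + \<i> * of_int b" "y = of_int c + \<i> * of_int d"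
    using assms by (metis gaussian_integersE)
  then have "x - y = of_int (a - c) + \<i> * of_int (b - d)"
    by (simp add: algebra_simps)
  then show ?thesis by (simp only: gaussian_integers_of_int)
qed

lemma gaussian_integers_add [intro]:
  assumes "x \<in> gaussian_integers" "y \<in> gaussian_integers"
  shows "x + y \<in> gaussian_integers"
  using gaussian_integers_diff[OF assms(1) gaussian_integers_diff[OF gaussian_integers_0 assms(2)]]
  by simp

lemma gaussian_int_mult:
  "(of_int a + \<i> * of_int b) * (of_int c + \<i> * of_int d) =
    (of_int (a * c - b * d) + \<i> * of_int (a * d + b * c) :: complex)"
  by (simp add: complex_eq_iff)

lemma gaussian_integers_mult [intro]:
  assumes "x \<in> gaussian_integers" "y \<in> gaussian_integers"
  shows "x * y \<in> gaussian_integers"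
  using assms by (metis gaussian_integersE gaussian_int_mult gaussian_integers_of_int)

lemma gaussian_int_eq_iff:
  "(of_int a + \<i> * of_int b :: complex) = of_int c + \<i> * of_int d \<longleftrightarrow> a = c \<and> b = d"
  by (simp add: complex_eq_iff)

lemma cmod_gaussian_int:
  "(cmod (of_int a + \<i> * of_int b))\<^sup>2 = of_int (a\<^sup>2 + b\<^sup>2)"
  by (simp add: cmod_power2)

lemma cnj_gaussian_integers [intro]:
  assumes "x \<in> gaussian_integers"
  shows "cnj x \<in> gaussian_integers"
proof -
  obtain a b where "x = of_int a + \<i> * of_int b"
    using assms by (rule gaussian_integersE)
  then have "cnj x = of_int a + \<i> * of_int (- b)" by simp
  then show ?thesis by (simp only: gaussian_integers_of_int)
qed

lemma gaussian_unit_gaussian_int: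
  "gaussian_unit (of_int a + \<i> * of_int b) \<longleftrightarrow> a\<^sup>2 + b\<^sup>2 = 1"
proof -
  have "cmod (of_int a + \<i> * of_int b) = 1 \<longleftrightarrow> (cmod (of_int a + \<i> * of_int b))\<^sup>2 = 1"
    by (simp add: power2_eq_1_iff) (smt (verit) norm_ge_zero)
  also have "\<dots> \<longleftrightarrow> a\<^sup>2 + b\<^sup>2 = 1"
    unfolding cmod_gaussian_int by linarith
  finally show ?thesis by (simp add: gaussian_unit_def)
qed

text \<open>Makes the conjugate available as the inverse of a unit, which is how units are cancelled
  later.\<close>

lemma gaussian_unit_cnj: "gaussian_unit x \<Longrightarrow> x * cnj x = 1"
  by (simp add: gaussian_unit_def complex_mult_cnj flip: cmod_power2)

section \<open>Euclidean division and Bezout in the Gaussian integers\<close>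

text \<open>Rounding each coordinate leaves an error of squared modulus at most 1/4 + 1/4, so a
  Euclidean remainder is strictly smaller than the divisor.\<close>

lemma nearest_gaussian_integer:
  obtains q where "q \<in> gaussian_integers" "cmod (x - q) < 1"
proof
  define q where "q = (of_int (round (Re x)) + \<i> * of_int (round (Im x)) :: complex)"
  show "q \<in> gaussian_integers" by (simp add: q_def)
  have "\<bar>Re (x - q)\<bar> \<le> 1/2" "\<bar>Im (x - q)\<bar> \<le> 1/2"
    using of_int_round_abs_le[of "Re x"] of_int_round_abs_le[of "Im x"]
    by (auto simp: q_def abs_minus_commute)
  then have "(Re (x - q))\<^sup>2 \<le> (1/2)\<^sup>2" "(Im (x - q))\<^sup>2 \<le> (1/2)\<^sup>2"
    by (auto simp only: abs_le_square_iff[symmetric])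
  then have "(cmod (x - q))\<^sup>2 < 1\<^sup>2"
    unfolding cmod_power2 by (simp add: power2_eq_square)
  then show "cmod (x - q) < 1"
    by (rule power_less_imp_less_base) simp
qed

text \<open>\<open>u * z + v * w\<close> is a greatest common divisor: a nonzero element of least
  norm in the ideal generated by \<open>z\<close> and \<open>w\<close> divides every element of that
  ideal.\<close>

lemma gaussian_bezout:
  assumes G: "z \<in> gaussian_integers" "w \<in> gaussian_integers" and "z \<noteq> 0"
  obtains u v s t where "u \<in> gaussian_integers" "v \<in> gaussian_integers"
    "s \<in> gaussian_integers" "t \<in> gaussian_integers"
    "z = (u * z + v * w) * s" "w = (u * z + v * w) * t"
proof -
  define I where "I = {u * z + v * w | u v. u \<in> gaussian_integers \<and> v \<in> gaussian_integers}"
  \<comment> \<open>The norm is taken in the natural numbers so that a least one exists. The floor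
    changes nothing on Gaussian integers, whose squared modulus is an integer.\<close>
  define N where "N x = nat \<lfloor>(cmod x)\<^sup>2\<rfloor>" for x
  have IG: "x \<in> gaussian_integers" if "x \<in> I" for x
    using that unfolding I_def by (auto simp: gaussian_integers_add gaussian_integers_mult G)
  have N: "real (N x) = (cmod x)\<^sup>2" if x: "x \<in> gaussian_integers" for x
  proof -
    obtain a b where "x = of_int a + \<i> * of_int b"
      using x by (rule gaussian_integersE)
    then have "(cmod x)\<^sup>2 = of_int (a\<^sup>2 + b\<^sup>2)"
      by (simp only: cmod_gaussian_int)
    then show ?thesis
      unfolding N_def by (simp only: floor_of_int) simp
  qed
  have zI: "z \<in> I"
    unfolding I_def by (rule CollectI, rule exI[of _ 1], rule exI[of _ 0]) simp
  have wI: "w \<in> I"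
    unfolding I_def by (rule CollectI, rule exI[of _ 0], rule exI[of _ 1]) simp
  \<comment> \<open>Since \<open>z\<close> is a nonzero member of \<open>I\<close>, there is
    something to minimize over.\<close>
  obtain g where g: "g \<in> I" "g \<noteq> 0" and least: "\<And>x. x \<in> I \<Longrightarrow> x \<noteq> 0 \<Longrightarrow> N g \<le> N x"
    using ex_has_least_nat[of "\<lambda>x. x \<in> I \<and> x \<noteq> 0" z N] zI \<open>z \<noteq> 0\<close> by blast
  have dvd: "\<exists>q \<in> gaussian_integers. x = g * q" if x: "x \<in> I" for x
  proof -
    obtain q where q: "q \<in> gaussian_integers" "cmod (x / g - q) < 1"
      by (rule nearest_gaussian_integer)
    \<comment> \<open>The remainder of \<open>x\<close> modulo \<open>g\<close> stays in the ideal
      and has smaller norm than \<open>g\<close>, so minimality forces it to vanish.\<close>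
    define r where "r = x - g * q"
    obtain u v u' v' where uv: "u \<in> gaussian_integers" "v \<in> gaussian_integers"
      "u' \<in> gaussian_integers" "v' \<in> gaussian_integers" "x = u * z + v * w" "g = u' * z + v' * w"
      using x g(1) unfolding I_def by blast
    have "r = (u - u' * q) * z + (v - v' * q) * w"
      unfolding r_def uv(5,6) by (simp add: algebra_simps)
    moreover have "u - u' * q \<in> gaussian_integers" "v - v' * q \<in> gaussian_integers"
      using uv(1-4) q(1) by (simp_all add: gaussian_integers_diff gaussian_integers_mult)
    ultimately have "r \<in> I"
      unfolding I_def by auto
    have "r = g * (x / g - q)"
      using g(2) by (simp add: r_def right_diff_distrib)
    then have "cmod r < cmod g"
      using q(2) g(2) by (simp add: norm_mult)
    then have "(cmod r)\<^sup>2 < (cmod g)\<^sup>2"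
      by (simp add: power_strict_mono)
    then have "N r < N g"
      using N[OF IG[OF \<open>r \<in> I\<close>]] N[OF IG[OF g(1)]] by linarith
    then have "r = 0"
      using least[OF \<open>r \<in> I\<close>] by fastforce
    then show ?thesis
      using q(1) by (auto simp: r_def)
  qed
  obtain u v where "u \<in> gaussian_integers" "v \<in> gaussian_integers" "g = u * z + v * w"
    using g(1) unfolding I_def by auto
  with dvd[OF zI] dvd[OF wI] show thesis
    using that by metis
qed

section \<open>Rational factors of a Gaussian prime and of its norm\<close>

text \<open>Both coordinates of \<open>q\<close> inherit being nonzero, so \<open>q\<close> has norm
  at least 2 and is not a unit. On the real axis this fails: 3 = 3 * 1 is a Gaussian prime.\<close>

lemma gaussian_prime_not_of_int_mult:
  assumes z: "gaussian_prime z" "z = of_int a + \<i> * of_int b" and ab: "a \<noteq> 0" "b \<noteq> 0"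
    and m: "m > 1" and q: "q \<in> gaussian_integers" "z = of_int m * q"
  shows False
proof -
  obtain c d where cd: "q = of_int c + \<i> * of_int d"
    using q(1) by (rule gaussian_integersE)
  have "z = of_int (m * c) + \<i> * of_int (m * d)"
    unfolding q(2) cd by (simp add: algebra_simps)
  then have "a = m * c \<and> b = m * d"
    unfolding z(2) gaussian_int_eq_iff .
  with ab have "c \<noteq> 0" "d \<noteq> 0" by auto
  then have "c\<^sup>2 > 0" "d\<^sup>2 > 0" by simp_all
  then have "\<not> gaussian_unit q"
    unfolding cd gaussian_unit_gaussian_int by linarith
  moreover have "\<not> gaussian_unit (of_int m)"
    using m by (simp add: gaussian_unit_def)
  ultimately show False
    using z(1) q unfolding gaussian_prime_def by blast
qed

text \<open>Factors of the matrix of \<open>z\<close> need not have the form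
  \<open>gaussian_matrix\<close>, so the determinants are all that is used of them; they enter here
  as \<open>d\<close> and \<open>e\<close>.\<close>

lemma gaussian_prime_norm_not_mult:
  assumes z: "gaussian_prime z" "z = of_int a + \<i> * of_int b" and ab: "a \<noteq> 0" "b \<noteq> 0"
    and de: "a\<^sup>2 + b\<^sup>2 = d * e" "d > 1" "e > 1"
  shows False
proof -
  have zG: "z \<in> gaussian_integers" using z(2) by simp
  have "z \<noteq> 0"
    using z(2) ab gaussian_int_eq_iff[of a b 0 0] by simp
  have zz: "z * cnj z = of_int d * of_int e"
    unfolding complex_norm_square[symmetric] z(2) cmod_gaussian_int de(1) by simp
  note no_int_dvd = gaussian_prime_not_of_int_mult[OF z ab]
  obtain u v s t where G: "u \<in> gaussian_integers" "v \<in> gaussian_integers"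
    "s \<in> gaussian_integers" "t \<in> gaussian_integers"
    and zs: "z = (u * z + v * of_int d) * s" and dt: "of_int d = (u * z + v * of_int d) * t"
    using gaussian_bezout[OF zG of_int_in_gaussian_integers \<open>z \<noteq> 0\<close>] by blast
  define g where "g = u * z + v * of_int d"
  have gG: "g \<in> gaussian_integers"
    using G zG unfolding g_def by blast
  have "gaussian_unit g \<or> gaussian_unit s"
    using z(1) gG G(3) zs unfolding g_def gaussian_prime_def by blast
  then show False
  proof
    assume "gaussian_unit g"
    \<comment> \<open>Inserting \<open>g * cnj g = 1\<close> and expanding the first
      \<open>g\<close> gives one term with \<open>z * cnj z = d * e\<close> and one with the
      explicit factor \<open>d\<close>. Conjugation then moves the divisibility to \<open>z\<close>,
      as \<open>d\<close> is real.\<close>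
    then have "cnj z = cnj z * (g * cnj g)" by (simp add: gaussian_unit_cnj)
    also have "\<dots> = (u * (z * cnj z) + v * of_int d * cnj z) * cnj g"
      by (simp add: g_def algebra_simps)
    also have "\<dots> = of_int d * ((u * of_int e + v * cnj z) * cnj g)"
      by (simp add: zz algebra_simps)
    finally have "z = of_int d * cnj ((u * of_int e + v * cnj z) * cnj g)"
      by (metis complex_cnj_cnj complex_cnj_mult complex_cnj_of_int)
    moreover have "cnj ((u * of_int e + v * cnj z) * cnj g) \<in> gaussian_integers"
      by (intro cnj_gaussian_integers gaussian_integers_mult gaussian_integers_add
          of_int_in_gaussian_integers G zG gG)
    ultimately show False
      using no_int_dvd[OF \<open>d > 1\<close>] by metis
  next
    assume "gaussian_unit s"
    \<comment> \<open>Now \<open>z\<close> is an associate of \<open>g\<close>, which divides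
      \<open>d\<close>. Cancelling \<open>z\<close> in \<open>z * cnj z = d * e\<close> leaves
      \<open>e\<close> as a factor of \<open>cnj z\<close>.\<close>
    then have "g = g * s * cnj s"
      by (simp add: gaussian_unit_cnj mult.assoc)
    then have "g = z * cnj s" using zs by (metis g_def)
    then have d: "of_int d = z * cnj s * t" using dt by (simp add: g_def)
    then have "z * cnj z = z * (cnj s * t * of_int e)" unfolding zz by simp
    then have "cnj z = cnj s * t * of_int e" using \<open>z \<noteq> 0\<close> by simp
    then have "z = of_int e * cnj (cnj s * t)"
      by (metis complex_cnj_cnj complex_cnj_mult complex_cnj_of_int mult.commute)
    moreover have "cnj (cnj s * t) \<in> gaussian_integers"
      by (intro cnj_gaussian_integers gaussian_integers_mult G)
    ultimately show False
      using no_int_dvd[OF \<open>e > 1\<close>] by metis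
  qed
qed

section \<open>The matrix representation and the equivalence\<close>

lemma det_gaussian_matrix: "det (gaussian_matrix a b) = a\<^sup>2 + b\<^sup>2"
  by (simp add: gaussian_matrix_def det_2 power2_eq_square)

lemma gaussian_matrix_mult:
  "gaussian_matrix a b ** gaussian_matrix c d = gaussian_matrix (a * c - b * d) (a * d + b * c)"
  by (simp add: gaussian_matrix_def matrix_matrix_mult_def vec_eq_iff forall_2 sum_2)

text \<open>The determinant is a sum of two squares, which rules out the value -1.\<close>

lemma unimodular_gaussian_matrix:
  "unimodular (gaussian_matrix a b) \<longleftrightarrow> gaussian_unit (of_int a + \<i> * of_int b)"
  unfolding unimodular_def det_gaussian_matrix gaussian_unit_gaussian_int
  using sum_power2_ge_zero[of a b] by linarith

theorem mainTheorem5: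
  fixes a b :: int and z :: complex
  assumes "z = of_int a + \<i> * of_int b"
    and "a * b \<noteq> 0"
  shows "gaussian_prime z \<longleftrightarrow> prime_matrix (gaussian_matrix a b)"
proof
  assume prime: "gaussian_prime z"
  have ab: "a \<noteq> 0" "b \<noteq> 0" using assms(2) by auto
  then have pos: "a\<^sup>2 + b\<^sup>2 > 0" by (simp add: sum_power2_gt_zero_iff)
  show "prime_matrix (gaussian_matrix a b)"
    unfolding prime_matrix_def
  proof (intro conjI notI)
    assume "det (gaussian_matrix a b) = 0"
    then show False using pos by (simp add: det_gaussian_matrix)
  next
    assume "\<exists>A B. \<not> unimodular A \<and> \<not> unimodular B \<and> gaussian_matrix a b = A ** B"
    then obtain A B where AB: "\<not> unimodular A" "\<not> unimodular B" "gaussian_matrix a b = A ** B"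
      by blast
    have det: "a\<^sup>2 + b\<^sup>2 = det A * det B"
      using arg_cong[OF AB(3), of det] by (simp add: det_gaussian_matrix det_mul)
    with pos have "det A \<noteq> 0" "det B \<noteq> 0" by auto
    \<comment> \<open>The determinants may both be negative; passing to absolute values keeps their
      product, since the norm is positive.\<close>
    with AB have "\<bar>det A\<bar> > 1" "\<bar>det B\<bar> > 1" by (auto simp: unimodular_def)
    moreover have "a\<^sup>2 + b\<^sup>2 = \<bar>det A\<bar> * \<bar>det B\<bar>"
      using det pos by (simp flip: abs_mult)
    ultimately show False
      using gaussian_prime_norm_not_mult[OF prime assms(1) ab] by blast
  qed
next
  assume prime: "prime_matrix (gaussian_matrix a b)"
  show "gaussian_prime z"
    unfolding gaussian_prime_def
  proof (intro conjI notI)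
    show "z \<in> gaussian_integers" using assms(1) by simp
  next
    assume "\<exists>x\<in>gaussian_integers. \<exists>y\<in>gaussian_integers.
      \<not> gaussian_unit x \<and> \<not> gaussian_unit y \<and> z = x * y"
    then obtain x y where xy: "x \<in> gaussian_integers" "y \<in> gaussian_integers"
      "\<not> gaussian_unit x" "\<not> gaussian_unit y" "z = x * y" by blast
    obtain c d where x: "x = of_int c + \<i> * of_int d" using xy(1) by (rule gaussian_integersE)
    obtain e f where y: "y = of_int e + \<i> * of_int f" using xy(2) by (rule gaussian_integersE)
    have "a = c * e - d * f \<and> b = c * f + d * e"
      using xy(5) unfolding assms(1) x y gaussian_int_mult gaussian_int_eq_iff .
    \<comment> \<open>The representation is multiplicative and sends non-units to non-unimodular
      matrices, so a factorization of \<open>z\<close> carries over.\<close>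
    then have "gaussian_matrix a b = gaussian_matrix c d ** gaussian_matrix e f"
      by (simp add: gaussian_matrix_mult)
    then show False
      using prime xy(3,4) unfolding prime_matrix_def x y unimodular_gaussian_matrix[symmetric]
      by blast
  qed
qed

end
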